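(* Let $m\ge 1$, let $W\subset\mathbb{Z}^m$ be a finite set, and let $G$ be the infinite directed graph with vertex set $\mathbb{Z}^m$ in which, for $u,v\in\mathbb{Z}^m$, there is a directed edge from $u$ to $v$ if and only if $v-u\in W$. Fix a vertex of $G$. For $d\in\mathbb{N}$ let $f(d)$ be the number of distinct endpoints of the length-$d$ paths in $G$ starting at the fixed vertex, and let $g(d)$ be the number of vertices of $G$ at distance $d$ from the fixed vertex. Then there exist polynomials $P(d)$ and $Q(d)$ such that $f(d)=P(d)$ and $g(d)=Q(d)$ for all $d\gg 0$.
   Context: A path of length $d$ starting at $u_0$ is a sequence of vertices $u_0,u_1,\dots,u_d$ with a directed edge from $u_{i}$ to $u_{i+1}$ for each $0\le i<d$; vertices and edges may be repeated. A vertex $v$ is at distance $d$ from $u_0$ if there is a path of length $d$ from $u_0$ to $v$ and no path of smaller length from $u_0$ to $v$. Polynomials are in one variable with rational coefficients. "For all $d\gg 0$" means for all sufficiently large integers $d$. *)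

theory Defs
  imports
    "HOL-Analysis.Finite_Cartesian_Product"
    "HOL-Computational_Algebra.Polynomial"
    "Graph_Theory.Pair_Digraph"
    "Graph_Theory.Vertex_Walk"
begin

definition difference_digraph :: "'a::ab_group_add set \<Rightarrow> 'a pair_pre_digraph" where
  "difference_digraph W = \<lparr> pverts = UNIV, parcs = {(u, v). v - u \<in> W} \<rparr>"

text \<open>
  The paths considered here may repeat vertices and edges, so they are the vertex walks
  of the library and not its \<open>vpath\<close>. A walk of length \<open>d\<close> is a list of \<open>d + 1\<close> vertices.
\<close>

definition walk_endpoints :: "('a, 'b) pre_digraph \<Rightarrow> 'a \<Rightarrow> nat \<Rightarrow> 'a set" where
  "walk_endpoints G u d =
     {v. \<exists>p. vwalk p G \<and> hd p = u \<and> last p = v \<and> vwalk_length p = d}"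

definition vertices_at_distance :: "('a, 'b) pre_digraph \<Rightarrow> 'a \<Rightarrow> nat \<Rightarrow> 'a set" where
  "vertices_at_distance G u d =
     {v. v \<in> walk_endpoints G u d \<and> (\<forall>k<d. v \<notin> walk_endpoints G u k)}"

text \<open>
  The two sets are finite when \<open>W\<close> is, so their \<open>card\<close> is the actual number of elements.
\<close>

lemma finite_walk_endpoints:
  assumes "finite W"
  shows "finite (walk_endpoints (difference_digraph W) u d)"
proof (induction d arbitrary: u)
  case 0
  have "walk_endpoints (difference_digraph W) u 0 \<subseteq> {u}"
  proof
    fix v assume "v \<in> walk_endpoints (difference_digraph W) u 0"
    then obtain p where "p \<noteq> []" "hd p = u" "last p = v" "length p \<le> 1"
      by (auto simp: walk_endpoints_def vwalk_def)
    then show "v \<in> {u}" by (cases p) auto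
  qed
  then show ?case by (rule finite_subset) simp
next
  case (Suc d)
  have "walk_endpoints (difference_digraph W) u (Suc d) \<subseteq>
      (\<Union>w\<in>W. walk_endpoints (difference_digraph W) (u + w) d)"
  proof
    fix v assume "v \<in> walk_endpoints (difference_digraph W) u (Suc d)"
    then obtain p where p: "vwalk p (difference_digraph W)" "hd p = u" "last p = v"
        "length p = Suc (Suc d)"
      by (auto simp: walk_endpoints_def)
    then obtain x q where q: "p = u # x # q"
      by (cases p; cases "tl p") auto
    have "x - u \<in> W" "vwalk (x # q) (difference_digraph W)"
      using p(1) unfolding q vwalk_def by (auto simp: difference_digraph_def)
    moreover have "v \<in> walk_endpoints (difference_digraph W) x d"
      unfolding walk_endpoints_def using p q calculation(2)
      by (intro CollectI exI[of _ "x # q"]) auto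
    ultimately show "v \<in> (\<Union>w\<in>W. walk_endpoints (difference_digraph W) (u + w) d)"
      by (intro UN_I[of "x - u"]) auto
  qed
  moreover have "finite (\<Union>w\<in>W. walk_endpoints (difference_digraph W) (u + w) d)"
    using assms Suc by blast
  ultimately show ?case by (rule finite_subset)
qed

lemma finite_vertices_at_distance:
  assumes "finite W"
  shows "finite (vertices_at_distance (difference_digraph W) u d)"
  using finite_walk_endpoints[OF assms, of u d] unfolding vertices_at_distance_def
  by (rule rev_finite_subset) auto

end

theory Submission
  imports Defs
begin

text \<open>
  Up to the translation by the starting vertex, the endpoints of the walks of length \<open>d\<close> form the
  \<open>d\<close>-fold sumset \<open>dW = W + \<dots> + W\<close>, so the claim on \<open>f\<close> is Khovanskii's theorem: \<open>card (dW)\<close>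
  is eventually a polynomial in \<open>d\<close>. The claim on \<open>g\<close> follows from the same theorem for
  \<open>W \<union> {0}\<close>: the vertices that a walk of length at most \<open>d\<close> reaches form \<open>d(W \<union> {0})\<close>, so \<open>g\<close>
  is a difference of two consecutive values of the counting function of \<open>W \<union> {0}\<close>.

  The family \<open>dW\<close> is a combinatorial version of a graded algebra generated by \<open>W\<close> in degree one, and
  Khovanskii's theorem is the statement that its Hilbert function is eventually polynomial. As
  for Hilbert functions, the proof is by induction on the number of generators and needs a
  statement about all ideals: if \<open>A d \<subseteq> dW\<close> for all \<open>d\<close>, and adding an element of \<open>W\<close> takes \<open>A d\<close>
  into \<open>A (d + 1)\<close>, then \<open>card (A d)\<close> is eventually polynomial. To adjoin a generator \<open>w\<close>, write
  each \<open>x \<in> A d\<close> as \<open>x = iw + y\<close> with \<open>y \<in> (d - i)W\<close> and \<open>i\<close> as small as possible. The elements \<open>y\<close>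
  that occur for a given \<open>i\<close> form the difference of two ideals over \<open>W\<close>. Both ideals grow with \<open>i\<close>,
  hence they are constant from some \<open>i\<close> on, by a Noetherian property that is Dickson's lemma in
  disguise. Thus \<open>card (A d)\<close> is a sum over \<open>i \<le> d\<close> of eventually polynomial functions of \<open>d - i\<close>,
  all but finitely many of them equal, and such a sum is eventually polynomial.
\<close>

section \<open>Eventually polynomial functions\<close>

definition eventually_poly :: "(nat \<Rightarrow> rat) \<Rightarrow> bool" where
  "eventually_poly f \<longleftrightarrow> (\<exists>P. \<forall>\<^sub>F d in sequentially. f d = poly P (of_nat d))"

lemma eventually_polyI:
  assumes "\<And>d. d \<ge> n \<Longrightarrow> f d = poly P (of_nat d)"
  shows "eventually_poly f"
  unfolding eventually_poly_def eventually_sequentially using assms by (intro exI allI impI)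

lemma eventually_polyE:
  assumes "eventually_poly f"
  obtains P n where "\<forall>d\<ge>n. f d = poly P (of_nat d)"
  using assms unfolding eventually_poly_def eventually_sequentially by (elim exE) (rule that)

lemma eventually_poly_cong:
  assumes "eventually_poly g" "\<And>d. d \<ge> n \<Longrightarrow> f d = g d"
  shows "eventually_poly f"
proof -
  obtain P m where "\<forall>d\<ge>m. g d = poly P (of_nat d)"
    using assms(1) by (rule eventually_polyE)
  then show ?thesis
    using assms(2) by (intro eventually_polyI[where n = "max m n" and P = P]) simp
qed

lemma eventually_poly_const: "eventually_poly (\<lambda>d. c)"
  by (rule eventually_polyI[where n = 0 and P = "[:c:]"]) simp

lemma eventually_poly_add:
  assumes "eventually_poly f" "eventually_poly g"
  shows "eventually_poly (\<lambda>d. f d + g d)"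
proof -
  obtain P m Q n where "\<forall>d\<ge>m. f d = poly P (of_nat d)"
      "\<forall>d\<ge>n. g d = poly Q (of_nat d)"
    using assms by (metis eventually_polyE)
  then show ?thesis
    by (intro eventually_polyI[where n = "max m n" and P = "P + Q"]) simp
qed

lemma eventually_poly_diff:
  assumes "eventually_poly f" "eventually_poly g"
  shows "eventually_poly (\<lambda>d. f d - g d)"
proof -
  obtain P m Q n where "\<forall>d\<ge>m. f d = poly P (of_nat d)"
      "\<forall>d\<ge>n. g d = poly Q (of_nat d)"
    using assms by (metis eventually_polyE)
  then show ?thesis
    by (intro eventually_polyI[where n = "max m n" and P = "P - Q"]) simp
qed

lemma eventually_poly_sum:
  assumes "\<And>i. i \<in> I \<Longrightarrow> eventually_poly (f i)"
  shows "eventually_poly (\<lambda>d. \<Sum>i\<in>I. f i d)"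
  using assms
  by (induction I rule: infinite_finite_induct)
    (auto intro: eventually_poly_add eventually_poly_const)

lemma eventually_poly_shift:
  assumes "eventually_poly f"
  shows "eventually_poly (\<lambda>d. f (d - c))"
proof -
  obtain P n where P: "\<forall>d\<ge>n. f d = poly P (of_nat d)"
    using assms by (rule eventually_polyE)
  show ?thesis
    by (rule eventually_polyI[where n = "n + c" and P = "pcompose P [:- of_nat c, 1:]"])
      (simp add: P poly_pcompose of_nat_diff)
qed

text \<open>
  For the power \<open>x ^ n\<close>, the difference of \<open>x ^ (n + 1)\<close> is \<open>(n + 1) * x ^ n\<close> up to smaller
  powers of \<open>x\<close>, which have antidifferences by induction.
\<close>

lemma poly_antidifference_power:
  "\<exists>Q :: rat poly. \<forall>x. poly Q (x + 1) - poly Q x = x ^ n"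
proof (induction n rule: less_induct)
  case (less n)
  then obtain R :: "nat \<Rightarrow> rat poly"
    where R: "\<And>k x. k < n \<Longrightarrow> poly (R k) (x + 1) - poly (R k) x = x ^ k"
    by metis
  define Q where "Q = smult (1 / of_nat (Suc n))
    (monom 1 (Suc n) - (\<Sum>k<n. smult (of_nat (Suc n choose k)) (R k)))"
  have "poly Q (x + 1) - poly Q x = x ^ n" for x
  proof -
    have "(x + 1) ^ Suc n = (\<Sum>k\<le>Suc n. of_nat (Suc n choose k) * x ^ k)"
      using binomial_ring[of x 1 "Suc n"] by simp
    also have "\<dots> = (\<Sum>k<n. of_nat (Suc n choose k) * x ^ k) + of_nat (Suc n) * x ^ n + x ^ Suc n"
      by (simp add: lessThan_Suc_atMost[symmetric] del: sum.atMost_Suc)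
    also have "(\<Sum>k<n. of_nat (Suc n choose k) * x ^ k) =
        (\<Sum>k<n. of_nat (Suc n choose k) * (poly (R k) (x + 1) - poly (R k) x))"
      using R by (intro sum.cong) auto
    finally have "(x + 1) ^ Suc n - x ^ Suc n -
        (\<Sum>k<n. of_nat (Suc n choose k) * (poly (R k) (x + 1) - poly (R k) x)) =
        of_nat (Suc n) * x ^ n"
      by simp
    moreover have "of_nat (Suc n) * (poly Q (x + 1) - poly Q x) = (x + 1) ^ Suc n - x ^ Suc n -
        (\<Sum>k<n. of_nat (Suc n choose k) * (poly (R k) (x + 1) - poly (R k) x))"
      by (simp add: Q_def poly_monom poly_sum right_diff_distrib sum_subtractf
          del: of_nat_Suc power_Suc binomial_Suc_Suc)
    ultimately have "of_nat (Suc n) * (poly Q (x + 1) - poly Q x) = of_nat (Suc n) * x ^ n"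
      by simp
    then show ?thesis
      by (simp del: of_nat_Suc)
  qed
  then show ?case by blast
qed

lemma poly_antidifference:
  fixes P :: "rat poly"
  obtains Q where "\<And>x. poly Q (x + 1) - poly Q x = poly P x"
proof -
  obtain R :: "nat \<Rightarrow> rat poly"
    where R: "\<And>k x. poly (R k) (x + 1) - poly (R k) x = x ^ k"
    using poly_antidifference_power by metis
  have "poly (\<Sum>i\<le>degree P. smult (coeff P i) (R i)) (x + 1) -
      poly (\<Sum>i\<le>degree P. smult (coeff P i) (R i)) x = poly P x" for x
    by (simp add: poly_sum poly_altdef[of P] flip: sum_subtractf right_diff_distrib R)
  then show ?thesis by (rule that)
qed

lemma eventually_poly_partial_sums:
  assumes "eventually_poly f"
  shows "eventually_poly (\<lambda>d. \<Sum>j\<le>d. f j)"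
proof -
  obtain P n where P: "\<forall>d\<ge>n. f d = poly P (of_nat d)"
    using assms by (rule eventually_polyE)
  obtain Q where Q: "\<And>x. poly Q (x + 1) - poly Q x = poly P x"
    using poly_antidifference[of P] by blast
  define c where "c = (\<Sum>j\<le>n. f j) - poly Q (of_nat n + 1)"
  have "(\<Sum>j\<le>d. f j) = poly Q (of_nat d + 1) + c" if "d \<ge> n" for d
    using that
  proof (induction d rule: dec_induct)
    case base
    show ?case by (simp add: c_def)
  next
    case (step d)
    then show ?case
      using Q[of "of_nat d + 1"] by (simp add: P algebra_simps)
  qed
  then show ?thesis
    by (intro eventually_polyI[where n = n and P = "pcompose Q [:1, 1:] + [:c:]"])
      (simp add: poly_pcompose add.commute)
qed

text \<open>
  The terms with \<open>i \<ge> n\<close> make up a partial sum of the single function \<open>h n\<close>, and the other terms are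
  finitely many shifted functions.
\<close>

lemma eventually_poly_convolution:
  assumes poly: "\<And>i. eventually_poly (h i)" and stable: "\<And>i. i \<ge> n \<Longrightarrow> h i = h n"
  shows "eventually_poly (\<lambda>d. \<Sum>i\<le>d. h i (d - i))"
proof (rule eventually_poly_cong[where n = n])
  show "eventually_poly (\<lambda>d. (\<Sum>i<n. h i (d - i)) + (\<Sum>j\<le>d - n. h n j))"
    by (intro eventually_poly_add eventually_poly_sum eventually_poly_shift poly
        eventually_poly_shift[where f = "\<lambda>d. \<Sum>j\<le>d. h n j"] eventually_poly_partial_sums)
next
  fix d assume "d \<ge> n"
  have "(\<Sum>i\<le>d. h i (d - i)) = (\<Sum>i<n. h i (d - i)) + (\<Sum>i=n..d. h i (d - i))"
    using \<open>d \<ge> n\<close> by (subst sum.union_disjoint[symmetric]) (auto intro!: sum.cong)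
  also have "(\<Sum>i=n..d. h i (d - i)) = (\<Sum>i=n..d. h n (d - i))"
    using stable by (intro sum.cong refl) (metis atLeastAtMost_iff)
  also have "\<dots> = (\<Sum>j\<le>d - n. h n j)"
    by (rule sum.reindex_bij_witness[where i = "\<lambda>j. d - j" and j = "\<lambda>i. d - i"])
      (use \<open>d \<ge> n\<close> in auto)
  finally show "(\<Sum>i\<le>d. h i (d - i)) = (\<Sum>i<n. h i (d - i)) + (\<Sum>j\<le>d - n. h n j)" .
qed

section \<open>Iterated sumsets\<close>

primrec multiple :: "nat \<Rightarrow> 'a::comm_monoid_add \<Rightarrow> 'a" where
  "multiple 0 w = 0"
| "multiple (Suc n) w = w + multiple n w"

lemma multiple_add: "multiple (m + n) w = multiple m w + multiple n w"
  by (induction m) (simp_all add: add.assoc)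

lemma multiple_zero [simp]: "multiple n 0 = 0"
  by (induction n) simp_all

primrec iterated_sumset :: "'a::comm_monoid_add set \<Rightarrow> nat \<Rightarrow> 'a set" where
  "iterated_sumset W 0 = {0}"
| "iterated_sumset W (Suc d) = {w + y |w y. w \<in> W \<and> y \<in> iterated_sumset W d}"

lemma finite_iterated_sumset:
  assumes "finite W"
  shows "finite (iterated_sumset W d)"
proof (induction d)
  case (Suc d)
  have "iterated_sumset W (Suc d) = (\<lambda>(w, y). w + y) ` (W \<times> iterated_sumset W d)"
    by auto
  then show ?case using assms Suc by simp
qed simp

lemma iterated_sumset_empty: "iterated_sumset {} d = (if d = 0 then {0} else {})"
  by (cases d) auto

lemma iterated_sumset_mono: "V \<subseteq> W \<Longrightarrow> iterated_sumset V d \<subseteq> iterated_sumset W d"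
  by (induction d) auto

lemma multiple_add_iterated_sumset:
  assumes "w \<in> W" "y \<in> iterated_sumset W d"
  shows "multiple i w + y \<in> iterated_sumset W (i + d)"
proof (induction i)
  case (Suc i)
  then show ?case using assms(1) by (auto simp: add.assoc)
qed (use assms in simp)

lemma iterated_sumset_insert:
  "iterated_sumset (insert w W) d = (\<Union>i\<le>d. (+) (multiple i w) ` iterated_sumset W (d - i))"
proof (intro equalityI subsetI)
  fix x assume "x \<in> iterated_sumset (insert w W) d"
  then show "x \<in> (\<Union>i\<le>d. (+) (multiple i w) ` iterated_sumset W (d - i))"
  proof (induction d arbitrary: x)
    case (Suc d)
    then obtain v i y where v: "v \<in> insert w W" and i: "i \<le> d"
        and y: "y \<in> iterated_sumset W (d - i)" and x: "x = v + (multiple i w + y)"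
      by fastforce
    show ?case
    proof (cases "v = w")
      case True
      then show ?thesis
        using i x y by (intro UN_I[of "Suc i"] image_eqI[of _ _ y]) (auto simp: add.assoc)
    next
      case False
      then have "v + y \<in> iterated_sumset W (Suc d - i)"
        using v y i by (auto simp: Suc_diff_le)
      then show ?thesis
        using i x by (intro UN_I[of i] image_eqI[of _ _ "v + y"]) (auto simp: add.left_commute)
    qed
  qed simp
next
  fix x assume "x \<in> (\<Union>i\<le>d. (+) (multiple i w) ` iterated_sumset W (d - i))"
  then obtain i y where iy: "i \<le> d" "y \<in> iterated_sumset W (d - i)" "x = multiple i w + y"
    by blast
  then have "y \<in> iterated_sumset (insert w W) (d - i)"
    using iterated_sumset_mono[of W "insert w W"] by blast
  then show "x \<in> iterated_sumset (insert w W) d"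
    using multiple_add_iterated_sumset[of w "insert w W" y "d - i" i] iy by simp
qed

section \<open>The Noetherian property\<close>

text \<open>
  Every sequence has a monotone subsequence; a nonincreasing sequence of natural numbers is constant
  from the point where it attains its minimum.
\<close>

lemma nat_sequence_monotone_subsequence:
  fixes a :: "nat \<Rightarrow> nat"
  obtains r :: "nat \<Rightarrow> nat" where "strict_mono r" "mono (a \<circ> r)"
proof -
  obtain r where r: "strict_mono r" "monoseq (a \<circ> r)"
    using seq_monosub[of a] by (auto simp: comp_def)
  show ?thesis
  proof (cases "incseq (a \<circ> r)")
    case True
    then show ?thesis using r that by blast
  next
    case False
    then have dec: "decseq (a \<circ> r)"
      using r(2) by (simp add: monoseq_iff)
    define k where "k = (ARG_MIN (a \<circ> r) n. True)"
    have "(a \<circ> r) k \<le> (a \<circ> r) n" for n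
      unfolding k_def by (rule arg_min_nat_le) simp
    then have "(a \<circ> r) (n + k) = (a \<circ> r) k" for n
      using decseqD[OF dec, of k "n + k"] by (simp add: order_antisym)
    then have "mono (a \<circ> (\<lambda>n. r (n + k)))"
      by (simp add: mono_def)
    moreover have "strict_mono (\<lambda>n. r (n + k))"
      using r(1) by (simp add: strict_mono_def)
    ultimately show ?thesis using that by blast
  qed
qed

text \<open>
  This is Dickson's lemma for \<open>W\<close>-indexed tuples of natural numbers, transported along the map
  that sends a tuple to the corresponding sum of elements of \<open>W\<close>: one generator at a time, pass to
  a subsequence along which the multiplicity of that generator is nondecreasing.
\<close>

lemma iterated_sumset_dickson:
  fixes y :: "nat \<Rightarrow> 'a::ab_group_add"
  assumes "finite W" "\<And>n. y n \<in> iterated_sumset W (e n)"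
  shows "\<exists>r :: nat \<Rightarrow> nat. strict_mono r \<and> (\<forall>i j. i \<le> j \<longrightarrow> e (r i) \<le> e (r j) \<and>
    y (r j) - y (r i) \<in> iterated_sumset W (e (r j) - e (r i)))"
  using assms
proof (induction W arbitrary: y e rule: finite_induct)
  case empty
  then have "e n = 0 \<and> y n = 0" for n
    by (metis iterated_sumset_empty empty_iff singletonD)
  then show ?case
    by (intro exI[of _ "\<lambda>n. n"]) (simp add: strict_mono_def)
next
  case (insert w W)
  have "\<exists>a z. a \<le> e n \<and> z \<in> iterated_sumset W (e n - a) \<and> y n = multiple a w + z" for n
    using insert.prems[of n] unfolding iterated_sumset_insert by blast
  then obtain a z where a: "\<And>n. a n \<le> e n" and z: "\<And>n. z n \<in> iterated_sumset W (e n - a n)"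
      and y: "\<And>n. y n = multiple (a n) w + z n"
    by metis
  obtain r :: "nat \<Rightarrow> nat" where r: "strict_mono r" "mono (a \<circ> r)"
    by (rule nat_sequence_monotone_subsequence[of a])
  obtain s :: "nat \<Rightarrow> nat" where s: "strict_mono s"
      and es: "\<And>i j. i \<le> j \<Longrightarrow> e (r (s i)) - a (r (s i)) \<le> e (r (s j)) - a (r (s j))"
      and zs: "\<And>i j. i \<le> j \<Longrightarrow> z (r (s j)) - z (r (s i)) \<in> iterated_sumset W
        ((e (r (s j)) - a (r (s j))) - (e (r (s i)) - a (r (s i))))"
    using insert.IH[of "z \<circ> r" "\<lambda>n. e (r n) - a (r n)"] z by auto
  have "e (r (s i)) \<le> e (r (s j)) \<and> y (r (s j)) - y (r (s i)) \<in>
      iterated_sumset (insert w W) (e (r (s j)) - e (r (s i)))" if "i \<le> j" for i j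
  proof -
    let ?p = "r (s i)" and ?q = "r (s j)"
    have pq: "a ?p \<le> a ?q"
      using r(2) s that by (simp add: mono_def strict_mono_less_eq)
    have e: "e ?p \<le> e ?q"
      "(a ?q - a ?p) + ((e ?q - a ?q) - (e ?p - a ?p)) = e ?q - e ?p"
      using pq es[OF that] a[of ?p] a[of ?q] by linarith+
    have "z ?q - z ?p \<in> iterated_sumset (insert w W) ((e ?q - a ?q) - (e ?p - a ?p))"
      using zs[OF that] iterated_sumset_mono[of W "insert w W"] by blast
    from multiple_add_iterated_sumset[OF insertI1 this, of "a ?q - a ?p"]
    have "multiple (a ?q - a ?p) w + (z ?q - z ?p) \<in> iterated_sumset (insert w W) (e ?q - e ?p)"
      by (simp only: e(2))
    moreover have "multiple (a ?q) w = multiple (a ?p) w + multiple (a ?q - a ?p) w"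
      using multiple_add[of "a ?p" "a ?q - a ?p" w] pq by simp
    then have "y ?q - y ?p = multiple (a ?q - a ?p) w + (z ?q - z ?p)"
      by (simp add: y)
    ultimately show ?thesis using e(1) by simp
  qed
  moreover have "strict_mono (\<lambda>n. r (s n))"
    using r(1) s by (simp add: strict_mono_def)
  ultimately show ?case by (intro exI[of _ "\<lambda>n. r (s n)"]) simp
qed

definition graded_ideal :: "'a::comm_monoid_add set \<Rightarrow> (nat \<Rightarrow> 'a set) \<Rightarrow> bool" where
  "graded_ideal W A \<longleftrightarrow> (\<forall>d. A d \<subseteq> iterated_sumset W d) \<and>
     (\<forall>d. \<forall>w\<in>W. \<forall>y\<in>A d. w + y \<in> A (Suc d))"

lemma graded_ideal_add:
  assumes "graded_ideal W A" "y \<in> A d" "x \<in> iterated_sumset W k"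
  shows "x + y \<in> A (k + d)"
  using assms(3)
proof (induction k arbitrary: x)
  case (Suc k)
  then obtain w z where "x = w + z" "w \<in> W" "z + y \<in> A (k + d)"
    by auto
  then show ?case
    using assms(1) by (auto simp: graded_ideal_def add.assoc)
qed (use assms in simp)

text \<open>
  If the chain grows infinitely often, pick at each such step a new element. By Dickson's lemma, some
  new element is the sum of an earlier one and an element of an iterated sumset, so it already
  belonged to the chain before the step at which it was supposed to be new.
\<close>

lemma graded_ideal_chain_stabilizes:
  fixes A :: "nat \<Rightarrow> nat \<Rightarrow> 'a::ab_group_add set"
  assumes fin: "finite W" and ideal: "\<And>i. graded_ideal W (A i)"
    and chain: "\<And>i d. A i d \<subseteq> A (Suc i) d"
  obtains n where "\<forall>i\<ge>n. A i = A n"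
proof -
  define N where "N = {i. A (Suc i) \<noteq> A i}"
  have mono: "A i d \<subseteq> A j d" if "i \<le> j" for i j d
    using chain that by (rule lift_Suc_mono_le)
  have "finite N"
  proof (rule ccontr)
    assume inf: "infinite N"
    have "\<exists>d x. x \<in> A (Suc (enumerate N n)) d - A (enumerate N n) d" for n
    proof -
      have "enumerate N n \<in> N"
        using inf by (rule enumerate_in_set)
      then obtain d where "A (Suc (enumerate N n)) d \<noteq> A (enumerate N n) d"
        unfolding N_def by blast
      then show ?thesis using chain by blast
    qed
    then obtain e y where new: "\<And>n. y n \<in> A (Suc (enumerate N n)) (e n)"
        and old: "\<And>n. y n \<notin> A (enumerate N n) (e n)"
      by (metis Diff_iff)
    have "y n \<in> iterated_sumset W (e n)" for n
      using new ideal unfolding graded_ideal_def by blast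
    then obtain r :: "nat \<Rightarrow> nat" where r: "strict_mono r"
        and rW: "\<forall>i j. i \<le> j \<longrightarrow> e (r i) \<le> e (r j) \<and>
          y (r j) - y (r i) \<in> iterated_sumset W (e (r j) - e (r i))"
      using iterated_sumset_dickson[OF fin, of y e] by auto
    let ?p = "r 0" and ?q = "r 1"
    have "?p < ?q"
      using r by (simp add: strict_mono_def)
    then have "enumerate N ?p < enumerate N ?q"
      using inf by (rule enumerate_mono)
    then have "y ?p \<in> A (enumerate N ?q) (e ?p)"
      using new mono[of "Suc (enumerate N ?p)" "enumerate N ?q"] by auto
    then have "(y ?q - y ?p) + y ?p \<in> A (enumerate N ?q) ((e ?q - e ?p) + e ?p)"
      using rW by (intro graded_ideal_add[OF ideal]) auto
    then show False
      using old[of ?q] rW by simp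
  qed
  then obtain n where n: "\<And>i. i \<ge> n \<Longrightarrow> A (Suc i) = A i"
    unfolding N_def finite_nat_set_iff_bounded by (auto simp: not_less[symmetric])
  have "A i = A n" if "i \<ge> n" for i
    using that by (induction i rule: dec_induct) (simp_all add: n)
  then show ?thesis using that by blast
qed

section \<open>Khovanskii's theorem\<close>

lemma of_nat_card_Diff:
  assumes "B \<subseteq> A" "finite A"
  shows "(of_nat (card (A - B)) :: rat) = of_nat (card A) - of_nat (card B)"
proof -
  have "finite B"
    using assms by (rule finite_subset)
  then have "card (A - B) = card A - card B"
    using assms(1) by (rule card_Diff_subset)
  then show ?thesis
    using card_mono[OF assms(2,1)] by (simp add: of_nat_diff)
qed

text \<open>
  For \<open>A\<close> an ideal over \<open>insert w W\<close>, this is the contraction to \<open>W\<close> of the colon ideal of \<open>A\<close> by the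
  \<open>i\<close>-th power of the generator \<open>w\<close>, in additive notation.
\<close>

definition colon_ideal ::
    "'a::comm_monoid_add set \<Rightarrow> 'a \<Rightarrow> (nat \<Rightarrow> 'a set) \<Rightarrow> nat \<Rightarrow> nat \<Rightarrow> 'a set" where
  "colon_ideal W w A i e = {y \<in> iterated_sumset W e. multiple i w + y \<in> A (i + e)}"

text \<open>
  These are the \<open>y\<close> for which the representation \<open>multiple i w + y\<close> does not have the least possible
  multiplicity of \<open>w\<close>: some of the \<open>i\<close> summands \<open>w\<close> can be traded, together with \<open>y\<close>, for elements
  of \<open>W\<close>.
\<close>

definition reducible_ideal ::
    "'a::comm_monoid_add set \<Rightarrow> 'a \<Rightarrow> (nat \<Rightarrow> 'a set) \<Rightarrow> nat \<Rightarrow> nat \<Rightarrow> 'a set" where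
  "reducible_ideal W w A i e = {y \<in> colon_ideal W w A i e.
     \<exists>k. 0 < k \<and> k \<le> i \<and> multiple k w + y \<in> iterated_sumset W (k + e)}"

lemma finite_colon_ideal: "finite W \<Longrightarrow> finite (colon_ideal W w A i e)"
  by (simp add: colon_ideal_def finite_iterated_sumset)

lemma reducible_subset_colon_ideal: "reducible_ideal W w A i e \<subseteq> colon_ideal W w A i e"
  by (auto simp: reducible_ideal_def)

lemma graded_ideal_colon_ideal:
  assumes "graded_ideal (insert w W) A"
  shows "graded_ideal W (colon_ideal W w A i)"
  using assms by (auto simp: graded_ideal_def colon_ideal_def add.left_commute)

lemma graded_ideal_reducible_ideal:
  assumes "graded_ideal (insert w W) A"
  shows "graded_ideal W (reducible_ideal W w A i)"
  using graded_ideal_colon_ideal[OF assms, of i]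
  by (fastforce simp: graded_ideal_def reducible_ideal_def add.left_commute)

lemma colon_ideal_chain:
  assumes "graded_ideal (insert w W) A"
  shows "colon_ideal W w A i e \<subseteq> colon_ideal W w A (Suc i) e"
  using assms by (auto simp: graded_ideal_def colon_ideal_def add.assoc)

lemma reducible_ideal_chain:
  assumes "graded_ideal (insert w W) A"
  shows "reducible_ideal W w A i e \<subseteq> reducible_ideal W w A (Suc i) e"
  using colon_ideal_chain[OF assms, of i e] le_SucI by (auto simp: reducible_ideal_def)

text \<open>
  The summand for \<open>i\<close> counts the \<open>x \<in> A d\<close> for which \<open>i\<close> is the least multiplicity of \<open>w\<close> in a
  representation of \<open>x\<close> as a sum of \<open>d\<close> elements of \<open>insert w W\<close>.
\<close>

lemma card_graded_ideal_insert:
  fixes A :: "nat \<Rightarrow> 'a::ab_group_add set"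
  assumes fin: "finite W" and ideal: "graded_ideal (insert w W) A"
  shows "card (A d) =
    (\<Sum>i\<le>d. card (colon_ideal W w A i (d - i) - reducible_ideal W w A i (d - i)))"
proof -
  let ?B = "colon_ideal W w A" and ?C = "reducible_ideal W w A"
  let ?D = "\<lambda>i. (+) (multiple i w) ` (?B i (d - i) - ?C i (d - i))"
  have "A d = (\<Union>i\<le>d. ?D i)"
  proof (intro equalityI subsetI)
    fix x assume x: "x \<in> A d"
    define represents where
      "represents i \<longleftrightarrow> i \<le> d \<and> x \<in> (+) (multiple i w) ` iterated_sumset W (d - i)" for i
    have "x \<in> iterated_sumset (insert w W) d"
      using x ideal unfolding graded_ideal_def by blast
    then have "\<exists>i. represents i"
      unfolding iterated_sumset_insert represents_def by auto
    then obtain i where i: "represents i" and least: "\<And>j. j < i \<Longrightarrow> \<not> represents j"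
      by (metis exists_least_iff)
    obtain y where id: "i \<le> d" and y: "y \<in> iterated_sumset W (d - i)" "x = multiple i w + y"
      using i unfolding represents_def by blast
    have "y \<in> ?B i (d - i)"
      using x id y by (simp add: colon_ideal_def)
    moreover have "y \<notin> ?C i (d - i)"
    proof
      assume "y \<in> ?C i (d - i)"
      then obtain k where k: "0 < k" "k \<le> i"
          and ky: "multiple k w + y \<in> iterated_sumset W (k + (d - i))"
        unfolding reducible_ideal_def by blast
      have "k + (d - i) = d - (i - k)"
        using k id by simp
      moreover have "x = multiple (i - k) w + (multiple k w + y)"
        using multiple_add[of "i - k" k w] k y(2) by (simp add: add.assoc)
      ultimately have "represents (i - k)"
        unfolding represents_def using ky id by simp
      then show False
        using least[of "i - k"] k by simp
    qed
    ultimately show "x \<in> (\<Union>i\<le>d. ?D i)"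
      using id y(2) by blast
  qed (auto simp: colon_ideal_def)
  moreover have "finite (?B i e)" for i e
    using fin by (rule finite_colon_ideal)
  moreover have "?D i \<inter> ?D j = {}" if "i \<noteq> j" "i \<le> d" "j \<le> d" for i j
  proof -
    have False if ji: "j < i" "i \<le> d" and x: "x \<in> ?D i" "x \<in> ?D j" for i j x
    proof -
      obtain y z where y: "y \<in> ?B i (d - i)" "y \<notin> ?C i (d - i)" "x = multiple i w + y"
          and z: "z \<in> ?B j (d - j)" "x = multiple j w + z"
        using x by blast
      have "multiple i w = multiple j w + multiple (i - j) w"
        using multiple_add[of j "i - j" w] ji(1) by simp
      then have "multiple (i - j) w + y = z"
        using y(3) z(2) by (simp add: add.assoc)
      moreover have "i - j + (d - i) = d - j"
        using ji by simp
      ultimately have "multiple (i - j) w + y \<in> iterated_sumset W (i - j + (d - i))"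
        using z(1) by (simp add: colon_ideal_def)
      then have "y \<in> ?C i (d - i)"
        using y(1) ji(1) unfolding reducible_ideal_def by (intro CollectI conjI exI[of _ "i - j"]) auto
      then show False using y(2) by simp
    qed
    then show ?thesis
      using that by (metis disjoint_iff linorder_neqE_nat)
  qed
  ultimately have "card (A d) = (\<Sum>i\<le>d. card (?D i))"
    by (simp add: card_UN_disjoint)
  then show ?thesis
    by (simp add: card_image)
qed

theorem card_graded_ideal_eventually_poly:
  fixes A :: "nat \<Rightarrow> 'a::ab_group_add set"
  assumes "finite W" "graded_ideal W A"
  shows "eventually_poly (\<lambda>d. of_nat (card (A d)))"
  using assms
proof (induction W arbitrary: A rule: finite_induct)
  case empty
  have "A d = {}" if "d \<ge> 1" for d
    using empty that unfolding graded_ideal_def iterated_sumset_empty by force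
  then show ?case
    by (intro eventually_poly_cong[OF eventually_poly_const[of 0], of 1]) simp
next
  case (insert w W)
  let ?B = "colon_ideal W w A" and ?C = "reducible_ideal W w A"
  note idealB = graded_ideal_colon_ideal[OF insert.prems]
  note idealC = graded_ideal_reducible_ideal[OF insert.prems]
  obtain m where m: "\<forall>i\<ge>m. ?B i = ?B m"
    using \<open>finite W\<close> idealB colon_ideal_chain[OF insert.prems]
    by (rule graded_ideal_chain_stabilizes)
  obtain n where n: "\<forall>i\<ge>n. ?C i = ?C n"
    using \<open>finite W\<close> idealC reducible_ideal_chain[OF insert.prems]
    by (rule graded_ideal_chain_stabilizes)
  define h :: "nat \<Rightarrow> nat \<Rightarrow> rat"
    where "h i e = of_nat (card (?B i e)) - of_nat (card (?C i e))" for i e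
  have "eventually_poly (h i)" for i
    unfolding h_def by (intro eventually_poly_diff insert.IH idealB idealC)
  moreover have "h i = h (max m n)" if "i \<ge> max m n" for i
  proof -
    have "?B i = ?B (max m n)" "?C i = ?C (max m n)"
      using m n that by (metis max.boundedE max.cobounded1, metis max.boundedE max.cobounded2)
    then show ?thesis
      unfolding h_def by simp
  qed
  ultimately have "eventually_poly (\<lambda>d. \<Sum>i\<le>d. h i (d - i))"
    by (rule eventually_poly_convolution)
  moreover have "of_nat (card (?B i e - ?C i e)) = h i e" for i e
    unfolding h_def using reducible_subset_colon_ideal finite_colon_ideal[OF \<open>finite W\<close>]
    by (rule of_nat_card_Diff)
  ultimately show ?case
    by (simp add: card_graded_ideal_insert[OF \<open>finite W\<close> insert.prems])
qed

corollary khovanskii: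
  fixes W :: "'a::ab_group_add set"
  assumes "finite W"
  shows "eventually_poly (\<lambda>d. of_nat (card (iterated_sumset W d)))"
  using assms
  by (rule card_graded_ideal_eventually_poly) (auto simp: graded_ideal_def)

section \<open>Walks in the difference digraph\<close>

lemma walk_endpoints_difference_digraph:
  "walk_endpoints (with_proj (difference_digraph W)) u d = (+) u ` iterated_sumset W d"
proof (induction d arbitrary: u)
  case 0
  show ?case
  proof (intro equalityI subsetI)
    fix v assume "v \<in> walk_endpoints (with_proj (difference_digraph W)) u 0"
    then obtain p where "p \<noteq> []" "hd p = u" "last p = v" "length p \<le> 1"
      by (auto simp: walk_endpoints_def vwalk_def)
    then show "v \<in> (+) u ` iterated_sumset W 0"
      by (cases p) auto
  next
    fix v assume "v \<in> (+) u ` iterated_sumset W 0"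
    then show "v \<in> walk_endpoints (with_proj (difference_digraph W)) u 0"
      unfolding walk_endpoints_def
      by (intro CollectI exI[of _ "[u]"]) (auto simp: vwalk_def difference_digraph_def)
  qed
next
  case (Suc d)
  let ?G = "with_proj (difference_digraph W)"
  have "walk_endpoints ?G u (Suc d) = (\<Union>w\<in>W. walk_endpoints ?G (u + w) d)"
  proof (intro equalityI subsetI)
    fix v assume "v \<in> walk_endpoints ?G u (Suc d)"
    then obtain p where p: "vwalk p ?G" "hd p = u" "last p = v" "length p = Suc (Suc d)"
      by (auto simp: walk_endpoints_def)
    then obtain x q where q: "p = u # x # q"
      by (cases p; cases "tl p") auto
    have "x - u \<in> W" "vwalk (x # q) ?G"
      using p(1) unfolding q vwalk_def by (auto simp: difference_digraph_def)
    moreover from this have "v \<in> walk_endpoints ?G x d"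
      unfolding walk_endpoints_def using p q by (intro CollectI exI[of _ "x # q"]) auto
    ultimately show "v \<in> (\<Union>w\<in>W. walk_endpoints ?G (u + w) d)"
      by (intro UN_I[of "x - u"]) auto
  next
    fix v assume "v \<in> (\<Union>w\<in>W. walk_endpoints ?G (u + w) d)"
    then obtain w p where w: "w \<in> W" and p: "vwalk p ?G" "hd p = u + w" "last p = v"
        "vwalk_length p = d"
      by (auto simp: walk_endpoints_def)
    then obtain q where q: "p = (u + w) # q"
      by (cases p) (auto simp: vwalk_def)
    have "vwalk (u # p) ?G"
      using p(1) w unfolding q vwalk_def by (auto simp: difference_digraph_def)
    then show "v \<in> walk_endpoints ?G u (Suc d)"
      unfolding walk_endpoints_def using p q by (intro CollectI exI[of _ "u # p"]) auto
  qed
  also have "\<dots> = (\<Union>w\<in>W. (+) (u + w) ` iterated_sumset W d)"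
    by (simp add: Suc)
  also have "\<dots> = (+) u ` iterated_sumset W (Suc d)"
    by (auto simp: add.assoc)
  finally show ?case .
qed

lemma iterated_sumset_insert_zero:
  "iterated_sumset (insert 0 W) d = (\<Union>k\<le>d. iterated_sumset W k)"
proof -
  have "iterated_sumset (insert 0 W) d = (\<Union>i\<le>d. iterated_sumset W (d - i))"
    by (simp add: iterated_sumset_insert)
  also have "\<dots> = (\<Union>k\<le>d. iterated_sumset W k)"
  proof (intro equalityI UN_least)
    fix k assume "k \<in> {..d}"
    then show "iterated_sumset W k \<subseteq> (\<Union>i\<le>d. iterated_sumset W (d - i))"
      using UN_upper[of "d - k" "{..d}" "\<lambda>i. iterated_sumset W (d - i)"] by simp
  qed (simp add: UN_upper)
  finally show ?thesis .
qed

lemma vertices_at_distance_difference_digraph: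
  "vertices_at_distance (with_proj (difference_digraph W)) u (Suc d) =
    (+) u ` (iterated_sumset (insert 0 W) (Suc d) - iterated_sumset (insert 0 W) d)"
proof -
  have "vertices_at_distance (with_proj (difference_digraph W)) u (Suc d) =
      (+) u ` iterated_sumset W (Suc d) - (\<Union>k\<le>d. (+) u ` iterated_sumset W k)"
    unfolding vertices_at_distance_def walk_endpoints_difference_digraph less_Suc_eq_le by blast
  also have "\<dots> = (+) u ` (iterated_sumset W (Suc d) - (\<Union>k\<le>d. iterated_sumset W k))"
    by (simp only: image_set_diff[OF inj_on_add] image_UN)
  also have "iterated_sumset W (Suc d) - (\<Union>k\<le>d. iterated_sumset W k) =
      iterated_sumset (insert 0 W) (Suc d) - iterated_sumset (insert 0 W) d"
    unfolding iterated_sumset_insert_zero atMost_Suc by blast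
  finally show ?thesis .
qed

theorem theorem3p1:
  fixes W :: "(int ^ 'm) set" and u\<^sub>0 :: "int ^ 'm"
  assumes "finite W"
  defines "G \<equiv> with_proj (difference_digraph W)"
  defines "f \<equiv> (\<lambda>d. card (walk_endpoints G u\<^sub>0 d))"
    and "g \<equiv> (\<lambda>d. card (vertices_at_distance G u\<^sub>0 d))"
  shows "\<exists>P Q :: rat poly. \<forall>\<^sub>F d in sequentially.
           rat_of_nat (f d) = poly P (of_nat d) \<and> rat_of_nat (g d) = poly Q (of_nat d)"
proof -
  let ?F = "\<lambda>d. rat_of_nat (card (iterated_sumset (insert 0 W) d))"
  have "eventually_poly (\<lambda>d. of_nat (f d))"
    using khovanskii[OF assms(1)]
    by (simp add: f_def G_def walk_endpoints_difference_digraph card_image)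
  moreover have "eventually_poly (\<lambda>d. of_nat (g d))"
  proof (rule eventually_poly_cong[where n = 1])
    have "eventually_poly ?F"
      using assms(1) by (intro khovanskii) simp
    then show "eventually_poly (\<lambda>d. ?F d - ?F (d - 1))"
      by (intro eventually_poly_diff eventually_poly_shift[where f = ?F])
  next
    fix d :: nat assume "d \<ge> 1"
    then obtain k where d: "d = Suc k"
      by (cases d) auto
    have fin: "finite (iterated_sumset (insert 0 W) j)" for j
      using assms(1) by (intro finite_iterated_sumset) simp
    have sub: "iterated_sumset (insert 0 W) k \<subseteq> iterated_sumset (insert 0 W) (Suc k)"
      unfolding iterated_sumset_insert_zero by (intro UN_mono) auto
    have "g d = card (iterated_sumset (insert 0 W) (Suc k) - iterated_sumset (insert 0 W) k)"
      unfolding g_def G_def d vertices_at_distance_difference_digraph by (simp add: card_image)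
    also have "rat_of_nat \<dots> = ?F (Suc k) - ?F k"
      using sub fin by (rule of_nat_card_Diff)
    finally show "of_nat (g d) = ?F d - ?F (d - 1)"
      by (simp only: d diff_Suc_1)
  qed
  ultimately obtain P Q where "\<forall>\<^sub>F d in sequentially. rat_of_nat (f d) = poly P (of_nat d)"
      "\<forall>\<^sub>F d in sequentially. rat_of_nat (g d) = poly Q (of_nat d)"
    unfolding eventually_poly_def by auto
  then show ?thesis
    by (intro exI[of _ P] exI[of _ Q] eventually_conj)
qed

end
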